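(* Let $\varphi:X\to\mathbb{R}$ be a Lipschitz function. For any $\underline{x}\in\Omega_\varphi$, the function $H_\varphi(\underline{x},\cdot):X\to\mathbb{R}$ is a Lipschitz calibrated subaction of $\varphi$. Moreover, the relation $\underline{x}\sim\underline{y}$ on $\Omega_\varphi$ given by $$H_\varphi(\underline{x},\underline{y})+H_\varphi(\underline{y},\underline{x})=0\qquad(\underline{x},\underline{y}\in\Omega_\varphi)$$ is an equivalence relation.
   Context: $\mathbb{N}_0$ is the set of non-negative integers and $X=[0,1]^{\mathbb{N}_0}$ with metric $d(\underline{x},\underline{y})=\sum_{i\ge 0}|x_i-y_i|/2^i$; $\sigma:X\to X$ is the left shift, $(\sigma(\underline{x}))_i=x_{i+1}$. For $\psi:X\to\mathbb{R}$ and $n\in\mathbb{N}=\{1,2,\dots\}$, $S_n\psi=\sum_{i=0}^{n-1}\psi\circ\sigma^i$. For continuous $\varphi:X\to\mathbb{R}$, $\alpha_\varphi=\inf_\mu\int\varphi\,d\mu$, the infimum being over all $\sigma$-invariant Borel probability measures $\mu$ on $X$. For $\underline{x},\underline{y}\in X$, $n\in\mathbb{N}$, $\varepsilon>0$ let $B(\underline{x},\underline{y},n;\varepsilon)=\{\underline{z}\in X: d(\underline{x},\underline{z})<\varepsilon,\ d(\sigma^n(\underline{z}),\underline{y})<\varepsilon\}$. Mañé potential: $S_\varphi(\underline{x},\underline{y})=\lim_{\varepsilon\to0}\inf\{S_n(\varphi-\alpha_\varphi)(\underline{z}): n\in\mathbb{N},\ \underline{z}\in B(\underline{x},\underline{y},n;\varepsilon)\}$.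 Peierl's barrier: $H_\varphi(\underline{x},\underline{y})=\lim_{\varepsilon\to0}\liminf_{n\to\infty}\inf\{S_n(\varphi-\alpha_\varphi)(\underline{z}):\underline{z}\in B(\underline{x},\underline{y},n;\varepsilon)\}$, with $\inf\emptyset=+\infty$; a priori it may take the value $+\infty$. Aubry set: $\Omega_\varphi=\{\underline{x}\in X: S_\varphi(\underline{x},\underline{x})=0\}$. A continuous function $u:X\to\mathbb{R}$ is a subaction of $\varphi$ if $u(\underline{x})+\varphi(\underline{x})\ge u(\sigma(\underline{x}))+\alpha_\varphi$ for every $\underline{x}\in X$; a subaction is calibrated if moreover $\min_{\sigma(\underline{y})=\underline{x}}(\varphi(\underline{y})+u(\underline{y}))=u(\underline{x})+\alpha_\varphi$ for every $\underline{x}\in X$. *)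

theory Defs
  imports "HOL-Probability.Probability"
begin

typedef unit_seq = "{x :: nat \<Rightarrow> real. \<forall>i. 0 \<le> x i \<and> x i \<le> 1}"
  morphisms coord Abs_unit_seq
  by (rule exI[of _ "\<lambda>_. 0"]) simp

lemma coord_bounds: "0 \<le> coord x i" "coord x i \<le> 1"
  using coord[of x] by auto

lemma summable_coord_diff: "summable (\<lambda>i. \<bar>coord x i - coord y i\<bar> / 2 ^ i)"
proof (rule summable_comparison_test'[where N = 0])
  show "summable (\<lambda>i. (1 / 2 :: real) ^ i)"
    by (rule summable_geometric) simp
  fix i :: nat
  have "\<bar>coord x i - coord y i\<bar> \<le> 1"
    using coord_bounds[of x i] coord_bounds[of y i] by linarith
  then show "norm (\<bar>coord x i - coord y i\<bar> / 2 ^ i) \<le> (1 / 2) ^ i"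
    by (simp add: power_divide divide_right_mono)
qed

instantiation unit_seq :: metric_space
begin

definition dist_unit_seq :: "unit_seq \<Rightarrow> unit_seq \<Rightarrow> real" where
  "dist_unit_seq x y = (\<Sum>i. \<bar>coord x i - coord y i\<bar> / 2 ^ i)"

definition uniformity_unit_seq :: "(unit_seq \<times> unit_seq) filter" where
  "uniformity_unit_seq = (INF e\<in>{0<..}. principal {(x, y). dist x y < e})"

definition open_unit_seq :: "unit_seq set \<Rightarrow> bool" where
  "open_unit_seq U \<longleftrightarrow> (\<forall>x\<in>U. \<forall>\<^sub>F (x', y) in uniformity. x' = x \<longrightarrow> y \<in> U)"

instance
proof
  fix x y z :: unit_seq
  show "dist x y = 0 \<longleftrightarrow> x = y"
  proof
    assume "dist x y = 0"
    then have "\<forall>i. \<bar>coord x i - coord y i\<bar> / 2 ^ i = 0"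
      using suminf_eq_zero_iff[OF summable_coord_diff[of x y]]
      by (simp add: dist_unit_seq_def)
    then have "coord x = coord y"
      by auto
    then show "x = y"
      by (simp add: coord_inject)
  qed (simp add: dist_unit_seq_def)
  have "dist x y \<le> (\<Sum>i. \<bar>coord x i - coord z i\<bar> / 2 ^ i + \<bar>coord y i - coord z i\<bar> / 2 ^ i)"
    unfolding dist_unit_seq_def
    by (intro suminf_le summable_add summable_coord_diff)
       (simp add: add_divide_distrib[symmetric] divide_right_mono)
  also have "\<dots> = dist x z + dist y z"
    unfolding dist_unit_seq_def
    by (rule suminf_add[symmetric]) (rule summable_coord_diff)+
  finally show "dist x y \<le> dist x z + dist y z" .
qed (rule uniformity_unit_seq_def open_unit_seq_def)+

end

definition shift :: "unit_seq \<Rightarrow> unit_seq" where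
  "shift x = Abs_unit_seq (\<lambda>i. coord x (Suc i))"

lemma coord_shift: "coord (shift x) i = coord x (Suc i)"
  by (simp add: shift_def Abs_unit_seq_inverse coord_bounds)

definition birkhoff_sum :: "(unit_seq \<Rightarrow> real) \<Rightarrow> nat \<Rightarrow> unit_seq \<Rightarrow> real" where
  "birkhoff_sum \<psi> n x = (\<Sum>i<n. \<psi> ((shift ^^ i) x))"

definition invariant_measures :: "unit_seq measure set" where
  "invariant_measures = {M. prob_space M \<and> sets M = sets borel \<and> distr M borel shift = M}"

(* A real infimum, hence only meaningful for bounded Borel \<phi>, e.g. continuous ones. *)
definition ergodic_min :: "(unit_seq \<Rightarrow> real) \<Rightarrow> real" where
  "ergodic_min \<phi> = (INF M\<in>invariant_measures. integral\<^sup>L M \<phi>)"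

definition orbit_nbhd :: "unit_seq \<Rightarrow> unit_seq \<Rightarrow> nat \<Rightarrow> real \<Rightarrow> unit_seq set" where
  "orbit_nbhd x y n \<epsilon> = {z. dist x z < \<epsilon> \<and> dist ((shift ^^ n) z) y < \<epsilon>}"

(* Both potentials are ereal-valued, so that the infimum of the empty set is \<infinity>.
   The quantities are antitone in \<epsilon>, so the limits always exist in ereal. *)
definition mane_potential :: "(unit_seq \<Rightarrow> real) \<Rightarrow> unit_seq \<Rightarrow> unit_seq \<Rightarrow> ereal" where
  "mane_potential \<phi> x y = Lim (at_right 0) (\<lambda>\<epsilon>.
     INF (n, z)\<in>{(n, z). 1 \<le> n \<and> z \<in> orbit_nbhd x y n \<epsilon>}.
       ereal (birkhoff_sum (\<lambda>w. \<phi> w - ergodic_min \<phi>) n z))"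

definition peierls_barrier :: "(unit_seq \<Rightarrow> real) \<Rightarrow> unit_seq \<Rightarrow> unit_seq \<Rightarrow> ereal" where
  "peierls_barrier \<phi> x y = Lim (at_right 0) (\<lambda>\<epsilon>.
     liminf (\<lambda>n. INF z\<in>orbit_nbhd x y n \<epsilon>.
       ereal (birkhoff_sum (\<lambda>w. \<phi> w - ergodic_min \<phi>) n z)))"

definition aubry_set :: "(unit_seq \<Rightarrow> real) \<Rightarrow> unit_seq set" where
  "aubry_set \<phi> = {x. mane_potential \<phi> x x = 0}"

definition subaction :: "(unit_seq \<Rightarrow> real) \<Rightarrow> (unit_seq \<Rightarrow> real) \<Rightarrow> bool" where
  "subaction \<phi> u \<longleftrightarrow>
     continuous_on UNIV u \<and> (\<forall>x. u x + \<phi> x \<ge> u (shift x) + ergodic_min \<phi>)"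

(* The minimum over the infinite set of preimages is stated as a value attained at a minimiser. *)
definition calibrated_subaction :: "(unit_seq \<Rightarrow> real) \<Rightarrow> (unit_seq \<Rightarrow> real) \<Rightarrow> bool" where
  "calibrated_subaction \<phi> u \<longleftrightarrow> subaction \<phi> u \<and>
     (\<forall>x. \<exists>y. is_arg_min (\<lambda>y. \<phi> y + u y) (\<lambda>y. shift y = x) y \<and>
              \<phi> y + u y = u x + ergodic_min \<phi>)"

end

theory Submission
  imports Defs
begin

text \<open>Everything rests on one operation: keep the first \<open>n\<close> symbols of \<open>z\<close> and replace the rest by
  another sequence \<open>y\<close>, written \<open>graft n z y\<close>. The orbits of \<open>graft n z y\<close> and \<open>graft n z y'\<close> are
  at distance \<open>dist y y' / 2 ^ (n - i)\<close> at time \<open>i \<le> n\<close>, so for an \<open>L\<close>-Lipschitz function their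
  Birkhoff sums of length \<open>n\<close> differ by at most \<open>L * dist y y'\<close>, whatever \<open>n\<close> is
  (\<open>birkhoff_sum_graft_le\<close>). Write \<open>\<psi>\<close> for \<open>\<phi>\<close> minus its
  ergodic minimum and \<open>H\<close> for the barrier.

  Grafting a segment onto itself periodically compares any orbit segment with a periodic orbit. The
  latter carries an invariant measure, so its sum of \<open>\<psi>\<close> is nonnegative; hence a segment that returns
  within \<open>\<delta>\<close> of its start has a sum at least \<open>- 2 L \<delta>\<close> (\<open>birkhoff_sum_closing\<close>). This bounds
  the barrier from below and gives \<open>H x x \<ge> 0\<close>. If \<open>x\<close> lies in the Aubry set, repeating a cheap nearly
  closed segment many times gives long cheap ones, whence \<open>H x x \<le> 0\<close>
  (\<open>peierls_barrier_le_0_if_aubry\<close>).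

  The other properties of the barrier are operations on segments that end near \<open>y\<close>: changing
  the tail gives Lipschitz continuity and, starting from \<open>H x x = 0\<close>, finiteness; following
  the orbit for one more step gives the subaction inequality; cutting off the last step and using
  compactness of the set of symbols gives calibration; concatenation gives the triangle inequality.
  The relation is transitive since \<open>0 = H x x \<le> H x w + H w x\<close>, while the triangle inequality
  through \<open>y\<close> bounds \<open>H x w + H w x\<close> from above by \<open>(H x y + H y x) + (H y w + H w y) = 0\<close>.\<close>

section \<open>Replacing the tail of a sequence\<close>

lemma coord_shift_funpow: "coord ((shift ^^ n) x) i = coord x (i + n)"
  by (induction n arbitrary: i) (simp_all add: coord_shift)

lemma unit_seq_eqI: "(\<And>i. coord x i = coord y i) \<Longrightarrow> x = y"
  by (metis coord_inject ext)

lemma coord_Abs_unit_seq: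
  assumes "\<And>i. 0 \<le> f i \<and> f i \<le> 1"
  shows "coord (Abs_unit_seq f) i = f i"
  using assms by (simp add: Abs_unit_seq_inverse)

definition graft :: "nat \<Rightarrow> unit_seq \<Rightarrow> unit_seq \<Rightarrow> unit_seq" where
  "graft n z y = Abs_unit_seq (\<lambda>i. if i < n then coord z i else coord y (i - n))"

lemma coord_graft: "coord (graft n z y) i = (if i < n then coord z i else coord y (i - n))"
  unfolding graft_def by (subst coord_Abs_unit_seq) (auto simp: coord_bounds)

lemma shift_funpow_graft_le:
  "i \<le> n \<Longrightarrow> (shift ^^ i) (graft n z y) = graft (n - i) ((shift ^^ i) z) y"
  by (rule unit_seq_eqI) (auto simp: coord_shift_funpow coord_graft)

lemma shift_funpow_graft: "(shift ^^ n) (graft n z y) = y"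
  by (rule unit_seq_eqI) (auto simp: coord_shift_funpow coord_graft)

lemma graft_shift_funpow: "graft n z ((shift ^^ n) z) = z"
  by (rule unit_seq_eqI) (auto simp: coord_shift_funpow coord_graft)

lemma dist_unit_seq_split:
  "dist x y = dist ((shift ^^ n) x) ((shift ^^ n) y) / 2 ^ n
     + (\<Sum>i<n. \<bar>coord x i - coord y i\<bar> / 2 ^ i)"
proof -
  have "dist x y = (\<Sum>i. \<bar>coord x (i + n) - coord y (i + n)\<bar> / 2 ^ (i + n))
     + (\<Sum>i<n. \<bar>coord x i - coord y i\<bar> / 2 ^ i)"
    unfolding dist_unit_seq_def
    by (rule suminf_split_initial_segment[OF summable_coord_diff])
  also have "(\<Sum>i. \<bar>coord x (i + n) - coord y (i + n)\<bar> / 2 ^ (i + n))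
      = (\<Sum>i. \<bar>coord ((shift ^^ n) x) i - coord ((shift ^^ n) y) i\<bar> / 2 ^ i / 2 ^ n)"
    by (simp add: coord_shift_funpow power_add)
  also have "\<dots> = dist ((shift ^^ n) x) ((shift ^^ n) y) / 2 ^ n"
    unfolding dist_unit_seq_def by (rule suminf_divide[OF summable_coord_diff])
  finally show ?thesis .
qed

lemma dist_graft: "dist (graft n z y) (graft n z y') = dist y y' / 2 ^ n"
  by (subst dist_unit_seq_split[of _ _ n]) (simp add: shift_funpow_graft coord_graft)

lemma dist_graft_self: "dist (graft n z y) z = dist y ((shift ^^ n) z) / 2 ^ n"
  by (metis dist_graft graft_shift_funpow)

lemma dist_shift_le: "dist (shift x) (shift y) \<le> 2 * dist x y"
  using dist_unit_seq_split[of x y 1] by simp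

lemma dist_unit_seq_le_2: "dist x (y :: unit_seq) \<le> 2"
proof -
  have "dist x y \<le> (\<Sum>i. (1 / 2 :: real) ^ i)"
    unfolding dist_unit_seq_def
  proof (intro suminf_le summable_coord_diff summable_geometric)
    fix i
    have "\<bar>coord x i - coord y i\<bar> \<le> 1"
      using coord_bounds[of x i] coord_bounds[of y i] by linarith
    then show "\<bar>coord x i - coord y i\<bar> / 2 ^ i \<le> (1 / 2) ^ i"
      by (simp add: power_divide divide_right_mono)
  qed simp
  then show ?thesis
    by (simp add: suminf_geometric)
qed

lemma birkhoff_sum_add:
  "birkhoff_sum \<psi> (n + m) x = birkhoff_sum \<psi> n x + birkhoff_sum \<psi> m ((shift ^^ n) x)"
proof -
  have "birkhoff_sum \<psi> (n + m) x
      = birkhoff_sum \<psi> n x + (\<Sum>i<m. \<psi> ((shift ^^ (n + i)) x))"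
    unfolding birkhoff_sum_def by (induction m) auto
  moreover have "(shift ^^ (n + i)) x = (shift ^^ i) ((shift ^^ n) x)" for i
    by (metis add.commute comp_apply funpow_add)
  ultimately show ?thesis
    by (simp add: birkhoff_sum_def)
qed

lemma birkhoff_sum_Suc:
  "birkhoff_sum \<psi> (Suc n) x = birkhoff_sum \<psi> n x + \<psi> ((shift ^^ n) x)"
  by (simp add: birkhoff_sum_def)

text \<open>Two orbits that share their first \<open>n\<close> symbols approach each other geometrically when read
  backwards from time \<open>n\<close>, so the differences of \<open>\<psi>\<close> along them sum to at most
  \<open>L * (1/2 + 1/4 + \<dots>)\<close> times the distance of the tails, uniformly in \<open>n\<close>.\<close>

lemma birkhoff_sum_graft_le:
  assumes lip: "L-lipschitz_on UNIV \<psi>"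
  shows "birkhoff_sum \<psi> n (graft n z y) \<le> birkhoff_sum \<psi> n (graft n z y') + L * dist y y'"
proof -
  have L: "L \<ge> 0"
    using lip lipschitz_on_nonneg by blast
  have "birkhoff_sum \<psi> n (graft n z y) - birkhoff_sum \<psi> n (graft n z y')
      = (\<Sum>i<n. \<psi> ((shift ^^ i) (graft n z y)) - \<psi> ((shift ^^ i) (graft n z y')))"
    by (simp add: birkhoff_sum_def sum_subtractf)
  also have "\<dots> \<le> (\<Sum>i<n. L * dist y y' * (1 / 2) ^ (n - i))"
  proof (rule sum_mono)
    fix i assume "i \<in> {..<n}"
    then have "dist ((shift ^^ i) (graft n z y)) ((shift ^^ i) (graft n z y'))
        = dist y y' * (1 / 2) ^ (n - i)"
      by (simp add: shift_funpow_graft_le dist_graft power_divide)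
    then show "\<psi> ((shift ^^ i) (graft n z y)) - \<psi> ((shift ^^ i) (graft n z y'))
        \<le> L * dist y y' * (1 / 2) ^ (n - i)"
      using lipschitz_onD[OF lip UNIV_I UNIV_I,
          of "(shift ^^ i) (graft n z y)" "(shift ^^ i) (graft n z y')"]
      by (simp add: dist_real_def)
  qed
  also have "\<dots> = L * dist y y' * (\<Sum>i<n. (1 / 2) ^ (n - i))"
    by (simp add: sum_distrib_left)
  also have "(\<Sum>i<n. (1 / 2 :: real) ^ (n - i)) = 1 - (1 / 2) ^ n"
  proof (induction n)
    case (Suc n)
    have "(\<Sum>i<Suc n. (1 / 2 :: real) ^ (Suc n - i)) = (\<Sum>i<n. (1 / 2) ^ (n - i) / 2) + 1 / 2"
      by (simp add: Suc_diff_le)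
    also have "\<dots> = (1 - (1 / 2) ^ n) / 2 + 1 / 2"
      by (simp add: sum_divide_distrib[symmetric] Suc)
    finally show ?case
      by (simp add: field_simps)
  qed simp
  also have "L * dist y y' * (1 - (1 / 2) ^ n) \<le> L * dist y y' * 1"
    by (rule mult_left_mono) (auto simp: L)
  finally show ?thesis
    by simp
qed

lemma birkhoff_sum_graft_self_le:
  assumes "L-lipschitz_on UNIV \<psi>"
  shows "birkhoff_sum \<psi> n (graft n z y) \<le> birkhoff_sum \<psi> n z + L * dist y ((shift ^^ n) z)"
  using birkhoff_sum_graft_le[OF assms, of n z y "(shift ^^ n) z"]
  by (simp add: graft_shift_funpow)

section \<open>Periodic orbits and the lower bound for Birkhoff sums\<close>

lemma lipschitz_bounded:
  assumes "L-lipschitz_on UNIV (\<phi> :: unit_seq \<Rightarrow> real)"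
  obtains K where "\<And>x. \<bar>\<phi> x\<bar> \<le> K"
proof
  fix x
  let ?o = "undefined :: unit_seq"
  have "\<bar>\<phi> x - \<phi> ?o\<bar> \<le> L * dist x ?o"
    using lipschitz_onD[OF assms UNIV_I UNIV_I] by (simp add: dist_real_def)
  also have "\<dots> \<le> L * 2"
    using assms lipschitz_on_nonneg dist_unit_seq_le_2 by (intro mult_left_mono) auto
  finally show "\<bar>\<phi> x\<bar> \<le> L * 2 + \<bar>\<phi> ?o\<bar>"
    by linarith
qed

lemma ergodic_min_le:
  assumes lip: "L-lipschitz_on UNIV \<phi>" and M: "M \<in> invariant_measures"
  shows "ergodic_min \<phi> \<le> integral\<^sup>L M \<phi>"
  unfolding ergodic_min_def
proof (rule cINF_lower[OF _ M])
  obtain K where K: "\<And>x. \<bar>\<phi> x\<bar> \<le> K"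
    using lipschitz_bounded[OF lip] by blast
  show "bdd_below ((\<lambda>M. integral\<^sup>L M \<phi>) ` invariant_measures)"
  proof (rule bdd_belowI2)
    fix N :: "unit_seq measure" assume N: "N \<in> invariant_measures"
    then interpret prob_space N
      by (simp add: invariant_measures_def)
    have "\<phi> \<in> borel_measurable borel"
      using lip by (intro borel_measurable_continuous_onI) (rule lipschitz_on_continuous_on)
    moreover have "sets N = sets borel"
      using N by (simp add: invariant_measures_def)
    ultimately have "\<phi> \<in> borel_measurable N"
      by (simp cong: measurable_cong_sets)
    then have "integrable N \<phi>"
      using K by (intro integrable_const_bound[of _ K]) auto
    moreover have "- K \<le> \<phi> x" for x
      using K[of x] by linarith
    ultimately show "- K \<le> integral\<^sup>L N \<phi>"
      by (intro integral_ge_const) auto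
  qed
qed

lemma shift_measurable: "shift \<in> borel_measurable borel"
proof (rule borel_measurable_continuous_onI)
  have "2-lipschitz_on UNIV shift"
    by (rule lipschitz_onI) (auto simp: dist_shift_le)
  then show "continuous_on UNIV shift"
    by (rule lipschitz_on_continuous_on)
qed

text \<open>The uniform distribution on a periodic orbit is an invariant measure: the shift acts on the
  orbit as the cyclic permutation \<open>i \<mapsto> i + 1 mod n\<close> of its indices.\<close>

lemma birkhoff_sum_periodic_ge:
  assumes lip: "L-lipschitz_on UNIV \<phi>" and n: "n \<ge> 1" and p: "(shift ^^ n) p = p"
  shows "birkhoff_sum \<phi> n p \<ge> n * ergodic_min \<phi>"
proof -
  define U where "U = pmf_of_set {..<n}"
  define f where "f i = (shift ^^ i) p" for i
  define M where "M = distr (measure_pmf U) borel f"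
  have ne: "{..<n} \<noteq> {}"
    using n by (simp add: lessThan_empty_iff)
  interpret prob_space M
    unfolding M_def by (rule prob_space.prob_space_distr) (auto simp: measure_pmf.prob_space_axioms)
  define c where "c i = Suc i mod n" for i
  have bij: "bij_betw c {..<n} {..<n}"
    unfolding bij_betw_def
  proof
    show inj: "inj_on c {..<n}"
      by (rule inj_onI) (auto simp: c_def mod_Suc split: if_splits)
    show "c ` {..<n} = {..<n}"
      by (rule endo_inj_surj[OF _ _ inj]) (use n in \<open>auto simp: c_def\<close>)
  qed
  have f_c: "f (c i) = shift (f i)" if "i < n" for i
    using that p n by (auto simp: f_def c_def mod_Suc)
  have "distr M borel shift = distr (measure_pmf U) borel (shift \<circ> f)"
    unfolding M_def by (rule distr_distr) (auto simp: shift_measurable)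
  also have "\<dots> = distr (measure_pmf U) borel (f \<circ> c)"
    by (rule distr_cong_AE)
       (use ne f_c in \<open>auto simp: AE_measure_pmf_iff U_def set_pmf_of_set\<close>)
  also have "\<dots> = distr (distr (measure_pmf U) (count_space UNIV) c) borel f"
    by (rule distr_distr[symmetric]) auto
  also have "distr (measure_pmf U) (count_space UNIV) c = measure_pmf (map_pmf c U)"
    by (simp add: map_pmf_rep_eq)
  also have "map_pmf c U = U"
    unfolding U_def using map_pmf_of_set_bij_betw[OF bij ne] by simp
  finally have "distr M borel shift = M"
    by (simp add: M_def)
  then have "M \<in> invariant_measures"
    using prob_space_axioms by (simp add: invariant_measures_def M_def)
  then have "ergodic_min \<phi> \<le> integral\<^sup>L M \<phi>"
    by (rule ergodic_min_le[OF lip])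
  also have "\<dots> = measure_pmf.expectation U (\<lambda>i. \<phi> (f i))"
    unfolding M_def using lip
    by (intro integral_distr) (auto intro: borel_measurable_continuous_onI lipschitz_on_continuous_on)
  also have "\<dots> = birkhoff_sum \<phi> n p / n"
    using ne by (simp add: U_def integral_pmf_of_set birkhoff_sum_def f_def)
  finally show ?thesis
    using n by (simp add: field_simps)
qed

abbreviation normalized :: "(unit_seq \<Rightarrow> real) \<Rightarrow> unit_seq \<Rightarrow> real" where
  "normalized \<phi> \<equiv> (\<lambda>w. \<phi> w - ergodic_min \<phi>)"

lemma lipschitz_normalized:
  "L-lipschitz_on UNIV \<phi> \<Longrightarrow> L-lipschitz_on UNIV (normalized \<phi>)"
  by (simp add: lipschitz_on_def dist_real_def)

text \<open>For \<open>n \<ge> 1\<close>, repeating the first \<open>n\<close> symbols of \<open>z\<close> for ever gives a periodic point \<open>p\<close> whose Birkhoff sum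
  is nonnegative and which differs from \<open>z\<close> only in the tail. As \<open>dist p z\<close> is at most half of
  \<open>dist p ((shift ^^ n) z)\<close>, the tails are at distance at most \<open>2 * dist z ((shift ^^ n) z)\<close>.\<close>

lemma birkhoff_sum_closing:
  assumes lip: "L-lipschitz_on UNIV \<phi>"
  shows "birkhoff_sum (normalized \<phi>) n z \<ge> - (2 * L * dist z ((shift ^^ n) z))"
proof (cases "n = 0")
  case False
  define p where "p = Abs_unit_seq (\<lambda>i. coord z (i mod n))"
  have coord_p: "coord p i = coord z (i mod n)" for i
    unfolding p_def by (rule coord_Abs_unit_seq) (simp add: coord_bounds)
  have per: "(shift ^^ n) p = p"
    by (rule unit_seq_eqI) (simp add: coord_shift_funpow coord_p)
  have p: "p = graft n z p"
    using False by (intro unit_seq_eqI) (auto simp: coord_p coord_graft le_mod_geq)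
  define D where "D = dist p ((shift ^^ n) z)"
  have "dist p z = D / 2 ^ n"
    using dist_graft_self[of n z p] p by (simp add: D_def)
  also have "\<dots> \<le> D / 2 ^ 1"
    using False by (intro divide_left_mono power_increasing) (auto simp: D_def)
  finally have "D \<le> D / 2 + dist z ((shift ^^ n) z)"
    using dist_triangle[of p "(shift ^^ n) z" z] by (simp add: D_def)
  then have D: "D \<le> 2 * dist z ((shift ^^ n) z)"
    by simp
  have "0 \<le> birkhoff_sum (normalized \<phi>) n p"
    using birkhoff_sum_periodic_ge[OF lip _ per] False
    by (simp add: birkhoff_sum_def sum_subtractf)
  also have "\<dots> \<le> birkhoff_sum (normalized \<phi>) n z + L * D"
    using birkhoff_sum_graft_self_le[OF lipschitz_normalized[OF lip], of n z p] p
    by (simp add: D_def)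
  also have "L * D \<le> L * (2 * dist z ((shift ^^ n) z))"
    using D lip lipschitz_on_nonneg by (intro mult_left_mono) auto
  finally show ?thesis
    by simp
qed (simp add: birkhoff_sum_def)

lemma birkhoff_sum_ge:
  assumes lip: "L-lipschitz_on UNIV \<phi>"
  shows "birkhoff_sum (normalized \<phi>) n z \<ge> - (4 * L)"
proof -
  have "2 * L * dist z ((shift ^^ n) z) \<le> 2 * L * 2"
    using lip lipschitz_on_nonneg dist_unit_seq_le_2 by (intro mult_left_mono) auto
  then show ?thesis
    using birkhoff_sum_closing[OF lip, of z n] by simp
qed

section \<open>Upper bounds for the potentials in terms of orbit segments\<close>

lemma orbit_nbhd_mono: "\<epsilon> \<le> \<epsilon>' \<Longrightarrow> orbit_nbhd x y n \<epsilon> \<subseteq> orbit_nbhd x y n \<epsilon>'"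
  by (auto simp: orbit_nbhd_def)

lemma Lim_at_right_antimono:
  fixes f :: "real \<Rightarrow> ereal"
  assumes anti: "\<And>a b. 0 < a \<Longrightarrow> a \<le> b \<Longrightarrow> f b \<le> f a"
  shows "Lim (at_right 0) f = (SUP \<epsilon>\<in>{0<..}. f \<epsilon>)"
proof (rule tendsto_Lim)
  show "(f \<longlongrightarrow> (SUP \<epsilon>\<in>{0<..}. f \<epsilon>)) (at_right 0)"
  proof (rule order_tendstoI)
    fix a assume "a < (SUP \<epsilon>\<in>{0<..}. f \<epsilon>)"
    then obtain e where e: "e > 0" "a < f e"
      by (auto simp: less_SUP_iff)
    then have "a < f \<epsilon>" if "0 < \<epsilon>" "\<epsilon> < e" for \<epsilon>
      using anti[of \<epsilon> e] that by (meson less_imp_le less_le_trans)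
    with e show "\<forall>\<^sub>F \<epsilon> in at_right 0. a < f \<epsilon>"
      by (auto simp: eventually_at_right_field)
  next
    fix a assume "(SUP \<epsilon>\<in>{0<..}. f \<epsilon>) < a"
    then have "f \<epsilon> < a" if "\<epsilon> > 0" for \<epsilon>
      using that by (meson SUP_lessD greaterThan_iff)
    then show "\<forall>\<^sub>F \<epsilon> in at_right 0. f \<epsilon> < a"
      by (auto simp: eventually_at_right_field intro: exI[of _ 1])
  qed
qed simp

lemma ereal_le_iff_less_add:
  "(X :: ereal) \<le> ereal c \<longleftrightarrow> (\<forall>\<delta>>0. X < ereal (c + \<delta>))"
proof
  assume *: "\<forall>\<delta>>0. X < ereal (c + \<delta>)"
  show "X \<le> ereal c"
  proof (rule ereal_le_epsilon2)
    fix e :: real assume "e > 0"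
    with * have "X < ereal (c + e)"
      by blast
    then show "X \<le> ereal c + ereal e"
      by simp
  qed
next
  assume X: "X \<le> ereal c"
  show "\<forall>\<delta>>0. X < ereal (c + \<delta>)"
  proof (intro allI impI)
    fix \<delta> :: real assume "\<delta> > 0"
    then have "ereal c < ereal (c + \<delta>)"
      by simp
    with X show "X < ereal (c + \<delta>)"
      by (rule le_less_trans)
  qed
qed

lemma mane_potential_leD:
  assumes "mane_potential \<phi> x y \<le> ereal c" "\<epsilon> > 0" "\<delta> > 0"
  obtains n z where "n \<ge> 1" "z \<in> orbit_nbhd x y n \<epsilon>"
    "birkhoff_sum (normalized \<phi>) n z < c + \<delta>"
proof -
  define f where "f \<epsilon> = (INF (n, z)\<in>{(n, z). 1 \<le> n \<and> z \<in> orbit_nbhd x y n \<epsilon>}.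
       ereal (birkhoff_sum (normalized \<phi>) n z))" for \<epsilon>
  have "mane_potential \<phi> x y = (SUP \<epsilon>\<in>{0<..}. f \<epsilon>)"
    unfolding mane_potential_def f_def
    by (rule Lim_at_right_antimono, rule INF_superset_mono) (use orbit_nbhd_mono in blast)+
  then have "f \<epsilon> \<le> ereal c"
    using assms by (auto simp: SUP_le_iff)
  then have "f \<epsilon> < ereal (c + \<delta>)"
    using assms(3) by (simp add: ereal_le_iff_less_add)
  then show thesis
    unfolding f_def INF_less_iff by (auto intro: that)
qed

text \<open>All statements about the barrier are reduced to statements about finite orbit segments through
  this criterion; working with real upper bounds \<open>c\<close> avoids arithmetic with infinite values.\<close>

lemma peierls_barrier_le_iff:
  "peierls_barrier \<phi> x y \<le> ereal c \<longleftrightarrow>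
     (\<forall>\<epsilon>>0. \<forall>N. \<forall>\<delta>>0. \<exists>n\<ge>N. \<exists>z\<in>orbit_nbhd x y n \<epsilon>. birkhoff_sum (normalized \<phi>) n z < c + \<delta>)"
proof -
  define g where "g n \<epsilon> = (INF z\<in>orbit_nbhd x y n \<epsilon>.
       ereal (birkhoff_sum (normalized \<phi>) n z))" for n \<epsilon>
  have "peierls_barrier \<phi> x y = (SUP \<epsilon>\<in>{0<..}. liminf (\<lambda>n. g n \<epsilon>))"
    unfolding peierls_barrier_def g_def
  proof (rule Lim_at_right_antimono)
    fix a b :: real assume "a \<le> b"
    then show "liminf (\<lambda>n. INF z\<in>orbit_nbhd x y n b. ereal (birkhoff_sum (normalized \<phi>) n z))
        \<le> liminf (\<lambda>n. INF z\<in>orbit_nbhd x y n a. ereal (birkhoff_sum (normalized \<phi>) n z))"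
      by (intro Liminf_mono always_eventually allI INF_superset_mono orbit_nbhd_mono) auto
  qed
  then have "peierls_barrier \<phi> x y \<le> ereal c \<longleftrightarrow> (\<forall>\<epsilon>>0. \<forall>N. (INF n\<in>{N..}. g n \<epsilon>) \<le> ereal c)"
    by (auto simp: SUP_le_iff liminf_SUP_INF)
  also have "\<dots> \<longleftrightarrow> (\<forall>\<epsilon>>0. \<forall>N. \<forall>\<delta>>0. \<exists>n\<ge>N. g n \<epsilon> < ereal (c + \<delta>))"
    by (simp add: ereal_le_iff_less_add INF_less_iff Bex_def)
  finally show ?thesis
    by (simp add: g_def INF_less_iff)
qed

lemma peierls_barrier_leD:
  assumes "peierls_barrier \<phi> x y \<le> ereal c" "\<epsilon> > 0" "\<delta> > 0"
  obtains n z where "n \<ge> N" "dist x z < \<epsilon>" "dist ((shift ^^ n) z) y < \<epsilon>"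
    "birkhoff_sum (normalized \<phi>) n z < c + \<delta>"
proof -
  have "\<exists>n\<ge>N. \<exists>z\<in>orbit_nbhd x y n \<epsilon>. birkhoff_sum (normalized \<phi>) n z < c + \<delta>"
    using assms by (simp add: peierls_barrier_le_iff)
  then show thesis
    using that by (auto simp: orbit_nbhd_def)
qed

text \<open>One parameter \<open>\<epsilon>\<close> can control all errors at once, up to a constant factor \<open>K\<close>.\<close>

lemma peierls_barrier_leI:
  assumes "K > 0"
    and "\<And>\<epsilon> N. 0 < \<epsilon> \<Longrightarrow> \<exists>n\<ge>N. \<exists>z. dist x z \<le> K * \<epsilon> \<and> dist ((shift ^^ n) z) y \<le> K * \<epsilon> \<and>
            birkhoff_sum (normalized \<phi>) n z \<le> c + K * \<epsilon>"
  shows "peierls_barrier \<phi> x y \<le> ereal c"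
  unfolding peierls_barrier_le_iff
proof (intro allI impI)
  fix \<epsilon> \<delta> :: real and N assume *: "\<epsilon> > 0" "\<delta> > 0"
  define e where "e = min \<epsilon> \<delta> / (2 * K)"
  have e: "e > 0" "K * e < \<epsilon>" "K * e < \<delta>"
    using * assms(1) by (auto simp: e_def)
  obtain n z where "n \<ge> N" "dist x z \<le> K * e" "dist ((shift ^^ n) z) y \<le> K * e"
    "birkhoff_sum (normalized \<phi>) n z \<le> c + K * e"
    using assms(2)[OF e(1), of N] by blast
  then show "\<exists>n\<ge>N. \<exists>z\<in>orbit_nbhd x y n \<epsilon>. birkhoff_sum (normalized \<phi>) n z < c + \<delta>"
    using e by (intro exI[of _ n] conjI bexI[of _ z]) (auto simp: orbit_nbhd_def)
qed

section \<open>Regularity, calibration and the triangle inequality\<close>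

lemma peierls_barrier_bound:
  assumes "L-lipschitz_on UNIV \<phi>" "peierls_barrier \<phi> x y \<le> ereal c"
  shows "c \<ge> - (4 * L)"
proof (rule field_le_epsilon)
  fix \<delta> :: real assume "\<delta> > 0"
  then obtain n z where "birkhoff_sum (normalized \<phi>) n z < c + \<delta>"
    using peierls_barrier_leD[OF assms(2) zero_less_one, of \<delta> 0] by blast
  then show "- (4 * L) \<le> c + \<delta>"
    using birkhoff_sum_ge[OF assms(1), of n z] by linarith
qed

lemma peierls_barrier_lipschitz:
  assumes lip: "L-lipschitz_on UNIV \<phi>" and le: "peierls_barrier \<phi> x y \<le> ereal c"
  shows "peierls_barrier \<phi> x y' \<le> ereal (c + L * dist y y')"
proof (rule peierls_barrier_leI)
  have L: "L \<ge> 0"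
    using lip lipschitz_on_nonneg by blast
  then show "3 + L > 0"
    by simp
  fix \<epsilon> :: real and N :: nat assume \<epsilon>: "0 < \<epsilon>"
  (* The new tail perturbs the initial point by at most 2 / 2^n, which is small for large n. *)
  obtain N0 where N0: "(1 / 2 :: real) ^ N0 < \<epsilon>"
    using real_arch_pow_inv[OF \<epsilon>, of "1 / 2"] by auto
  obtain n z where n: "n \<ge> max N N0" and z: "dist x z < \<epsilon>" "dist ((shift ^^ n) z) y < \<epsilon>"
    "birkhoff_sum (normalized \<phi>) n z < c + \<epsilon>"
    using peierls_barrier_leD[OF le \<epsilon> \<epsilon>] by metis
  define w where "w = graft n z y'"
  have "dist w z \<le> 2 / 2 ^ n"
    unfolding w_def dist_graft_self by (intro divide_right_mono dist_unit_seq_le_2) simp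
  also have "\<dots> \<le> 2 * (1 / 2) ^ N0"
    using n power_decreasing[of N0 n "1 / 2 :: real"] by (simp add: power_divide)
  finally have "dist x w \<le> 3 * \<epsilon>"
    using dist_triangle[of x w z] z N0 by (simp add: dist_commute)
  then have "dist x w \<le> (3 + L) * \<epsilon>"
    using mult_nonneg_nonneg[of L \<epsilon>] L \<epsilon> unfolding distrib_right by linarith
  moreover have "birkhoff_sum (normalized \<phi>) n w \<le> c + L * dist y y' + (3 + L) * \<epsilon>"
  proof -
    have "dist y' ((shift ^^ n) z) \<le> dist y y' + \<epsilon>"
      using dist_triangle[of y' "(shift ^^ n) z" y] z by (simp add: dist_commute)
    then have "L * dist y' ((shift ^^ n) z) \<le> L * (dist y y' + \<epsilon>)"
      using L by (rule mult_left_mono)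
    then show ?thesis
      using birkhoff_sum_graft_self_le[OF lipschitz_normalized[OF lip], of n z y'] z \<epsilon>
      by (simp add: w_def algebra_simps)
  qed
  ultimately show "\<exists>n\<ge>N. \<exists>z. dist x z \<le> (3 + L) * \<epsilon> \<and> dist ((shift ^^ n) z) y' \<le> (3 + L) * \<epsilon>
      \<and> birkhoff_sum (normalized \<phi>) n z \<le> c + L * dist y y' + (3 + L) * \<epsilon>"
    using n \<epsilon> L by (intro exI[of _ n] conjI exI[of _ w]) (auto simp: w_def shift_funpow_graft)
qed

text \<open>Following an orbit segment from near \<open>x\<close> to near \<open>y\<close> for one more step ends near
  \<open>shift y\<close>, and the added term is nearly \<open>normalized \<phi> y\<close>.\<close>

lemma peierls_barrier_shift_le:
  assumes lip: "L-lipschitz_on UNIV \<phi>" and le: "peierls_barrier \<phi> x y \<le> ereal c"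
  shows "peierls_barrier \<phi> x (shift y) \<le> ereal (c + normalized \<phi> y)"
proof (rule peierls_barrier_leI)
  have L: "L \<ge> 0"
    using lip lipschitz_on_nonneg by blast
  then show "2 + L > 0"
    by simp
  fix \<epsilon> :: real and N :: nat assume \<epsilon>: "0 < \<epsilon>"
  obtain n z where n: "n \<ge> N" and z: "dist x z < \<epsilon>" "dist ((shift ^^ n) z) y < \<epsilon>"
    "birkhoff_sum (normalized \<phi>) n z < c + \<epsilon>"
    using peierls_barrier_leD[OF le \<epsilon> \<epsilon>] by metis
  have "normalized \<phi> ((shift ^^ n) z) - normalized \<phi> y \<le> L * dist ((shift ^^ n) z) y"
    using lipschitz_onD[OF lip UNIV_I UNIV_I, of "(shift ^^ n) z" y] by (simp add: dist_real_def)
  also have "\<dots> \<le> L * \<epsilon>"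
    using z L by (intro mult_left_mono) auto
  finally have "birkhoff_sum (normalized \<phi>) (Suc n) z \<le> c + normalized \<phi> y + (2 + L) * \<epsilon>"
    using z \<epsilon> by (simp add: birkhoff_sum_Suc algebra_simps)
  moreover have "dist ((shift ^^ Suc n) z) (shift y) \<le> 2 * \<epsilon>"
    using dist_shift_le[of "(shift ^^ n) z" y] z by simp
  moreover have "\<epsilon> \<le> (2 + L) * \<epsilon>" "2 * \<epsilon> \<le> (2 + L) * \<epsilon>"
    using L \<epsilon> by (simp_all add: distrib_right)
  ultimately show "\<exists>n\<ge>N. \<exists>z. dist x z \<le> (2 + L) * \<epsilon> \<and> dist ((shift ^^ n) z) (shift y) \<le> (2 + L) * \<epsilon>
      \<and> birkhoff_sum (normalized \<phi>) n z \<le> c + normalized \<phi> y + (2 + L) * \<epsilon>"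
    using n z by (intro exI[of _ "Suc n"] conjI exI[of _ z]) (auto simp del: funpow.simps)
qed

text \<open>Take orbit segments from near \<open>x\<close> to near \<open>y\<close> whose sums approach the barrier, and
  cut off their last step. The points reached one step before the end are close to preimages of \<open>y\<close>,
  each determined by a first symbol in the compact interval \<open>[0, 1]\<close>; a limit point of these symbols
  gives the preimage.\<close>

lemma peierls_barrier_preimage:
  assumes lip: "L-lipschitz_on UNIV \<phi>" and le: "peierls_barrier \<phi> x y \<le> ereal c"
  obtains y' where "shift y' = y" "peierls_barrier \<phi> x y' \<le> ereal (c - normalized \<phi> y')"
proof -
  have L: "L \<ge> 0"
    using lip lipschitz_on_nonneg by blast
  define e :: "nat \<Rightarrow> real" where "e k = 1 / (k + 1)" for k
  have e_pos: "e k > 0" for k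
    by (simp add: e_def)
  have "\<exists>n z. n \<ge> k \<and> dist x z < e k \<and> dist ((shift ^^ Suc n) z) y < e k \<and>
      birkhoff_sum (normalized \<phi>) (Suc n) z < c + e k" for k
  proof -
    obtain m z where "m \<ge> Suc k" "dist x z < e k" "dist ((shift ^^ m) z) y < e k"
      "birkhoff_sum (normalized \<phi>) m z < c + e k"
      using peierls_barrier_leD[OF le e_pos e_pos] by metis
    then show ?thesis
      by (intro exI[of _ "m - 1"] exI[of _ z]) auto
  qed
  then obtain n z where n: "\<And>k. n k \<ge> k" and xz: "\<And>k. dist x (z k) < e k"
    and zy: "\<And>k. dist ((shift ^^ Suc (n k)) (z k)) y < e k"
    and sum: "\<And>k. birkhoff_sum (normalized \<phi>) (Suc (n k)) (z k) < c + e k"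
    by metis
  define t where "t k = coord (z k) (n k)" for k
  have "\<forall>k. t k \<in> {0..1}"
    by (simp add: t_def coord_bounds)
  then obtain s r where s: "s \<in> {0..1}" and r: "strict_mono r" and lim: "(t \<circ> r) \<longlonglongrightarrow> s"
    using seq_compactE[OF compact_imp_seq_compact[OF compact_Icc]] by metis
  define y' where "y' = Abs_unit_seq (case_nat s (coord y))"
  have coord_y': "coord y' i = case_nat s (coord y) i" for i
    unfolding y'_def using s coord_bounds by (intro coord_Abs_unit_seq) (auto split: nat.split)
  have "shift y' = y"
    by (rule unit_seq_eqI) (simp add: coord_shift coord_y')
  have "peierls_barrier \<phi> x y' \<le> ereal (c - normalized \<phi> y')"
  proof (rule peierls_barrier_leI)
    show "2 + 2 * L > 0"
      using L by simp
    fix \<epsilon> :: real and N :: nat assume \<epsilon>: "0 < \<epsilon>"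
    obtain k where k: "e k < \<epsilon>"
      using nat_approx_posE[OF \<epsilon>] by (auto simp: e_def add.commute)
    obtain k' where k': "\<And>j. j \<ge> k' \<Longrightarrow> \<bar>t (r j) - s\<bar> < \<epsilon>"
      using LIMSEQ_D[OF lim \<epsilon>] by auto
    define j where "j = r (max N (max k k'))"
    have j: "j \<ge> max N (max k k')"
      unfolding j_def using r by (rule seq_suble)
    have "e j \<le> e k"
      using j by (simp add: e_def frac_le)
    then have ej: "e j < \<epsilon>"
      using k by linarith
    define w where "w = (shift ^^ n j) (z j)"
    have "dist w y' = dist ((shift ^^ Suc (n j)) (z j)) y / 2 + \<bar>t j - s\<bar>"
      using dist_unit_seq_split[of w y' 1] \<open>shift y' = y\<close>
      by (simp add: w_def t_def coord_y' coord_shift_funpow)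
    moreover have "\<bar>t j - s\<bar> < \<epsilon>"
      unfolding j_def by (rule k') simp
    ultimately have w: "dist w y' \<le> 2 * \<epsilon>"
      using zy[of j] ej by linarith
    have "normalized \<phi> y' - normalized \<phi> w \<le> L * dist w y'"
      using lipschitz_onD[OF lip UNIV_I UNIV_I, of w y'] by (simp add: dist_real_def)
    also have "\<dots> \<le> L * (2 * \<epsilon>)"
      using w L by (rule mult_left_mono)
    finally have "birkhoff_sum (normalized \<phi>) (n j) (z j) \<le> c - normalized \<phi> y' + (2 + 2 * L) * \<epsilon>"
      using sum[of j] ej \<epsilon> by (simp add: birkhoff_sum_Suc w_def algebra_simps)
    moreover have "\<epsilon> \<le> (2 + 2 * L) * \<epsilon>" "2 * \<epsilon> \<le> (2 + 2 * L) * \<epsilon>"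
      using L \<epsilon> by (simp_all add: distrib_right)
    moreover have "n j \<ge> N"
      using n[of j] j by linarith
    ultimately show "\<exists>n\<ge>N. \<exists>z. dist x z \<le> (2 + 2 * L) * \<epsilon> \<and>
        dist ((shift ^^ n) z) y' \<le> (2 + 2 * L) * \<epsilon> \<and>
        birkhoff_sum (normalized \<phi>) n z \<le> c - normalized \<phi> y' + (2 + 2 * L) * \<epsilon>"
      using xz[of j] ej w unfolding w_def
      by (intro exI[of _ "n j"] conjI exI[of _ "z j"]) auto
  qed
  with \<open>shift y' = y\<close> show thesis
    by (rule that)
qed

text \<open>Orbit segments from \<open>x\<close> to \<open>y\<close> and from \<open>y\<close> to \<open>w\<close> are concatenated by grafting the second onto
  the first.\<close>

lemma peierls_barrier_triangle:
  assumes lip: "L-lipschitz_on UNIV \<phi>"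
    and xy: "peierls_barrier \<phi> x y \<le> ereal c" and yw: "peierls_barrier \<phi> y w \<le> ereal d"
  shows "peierls_barrier \<phi> x w \<le> ereal (c + d)"
proof (rule peierls_barrier_leI)
  have L: "L \<ge> 0"
    using lip lipschitz_on_nonneg by blast
  then show "3 + 2 * L > 0"
    by simp
  fix \<epsilon> :: real and N :: nat assume \<epsilon>: "0 < \<epsilon>"
  obtain n z where n: "n \<ge> N" and z: "dist x z < \<epsilon>" "dist ((shift ^^ n) z) y < \<epsilon>"
    "birkhoff_sum (normalized \<phi>) n z < c + \<epsilon>"
    using peierls_barrier_leD[OF xy \<epsilon> \<epsilon>] by metis
  obtain m z' where z': "dist y z' < \<epsilon>" "dist ((shift ^^ m) z') w < \<epsilon>"
    "birkhoff_sum (normalized \<phi>) m z' < d + \<epsilon>"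
    using peierls_barrier_leD[OF yw \<epsilon> \<epsilon>] by metis
  define v where "v = graft n z z'"
  have v: "(shift ^^ n) v = z'"
    by (simp add: v_def shift_funpow_graft)
  have d: "dist z' ((shift ^^ n) z) \<le> 2 * \<epsilon>"
    using dist_triangle[of z' "(shift ^^ n) z" y] z z' by (simp add: dist_commute)
  have "dist v z \<le> dist z' ((shift ^^ n) z)"
    unfolding v_def dist_graft_self by (simp add: divide_le_eq mult_le_cancel_left1)
  then have "dist x v \<le> 3 * \<epsilon>"
    using dist_triangle[of x v z] z d by (simp add: dist_commute)
  moreover have "(shift ^^ (n + m)) v = (shift ^^ m) z'"
    using v by (metis add.commute comp_apply funpow_add)
  moreover have "birkhoff_sum (normalized \<phi>) (n + m) v \<le> c + d + (3 + 2 * L) * \<epsilon>"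
  proof -
    have "L * dist z' ((shift ^^ n) z) \<le> L * (2 * \<epsilon>)"
      using d L by (rule mult_left_mono)
    then show ?thesis
      using birkhoff_sum_graft_self_le[OF lipschitz_normalized[OF lip], of n z z'] z z' \<epsilon>
      unfolding birkhoff_sum_add v by (simp add: v_def algebra_simps)
  qed
  moreover have "\<epsilon> \<le> (3 + 2 * L) * \<epsilon>" "3 * \<epsilon> \<le> (3 + 2 * L) * \<epsilon>"
    using L \<epsilon> by (simp_all add: distrib_right)
  ultimately show "\<exists>n\<ge>N. \<exists>z. dist x z \<le> (3 + 2 * L) * \<epsilon> \<and> dist ((shift ^^ n) z) w \<le> (3 + 2 * L) * \<epsilon>
      \<and> birkhoff_sum (normalized \<phi>) n z \<le> c + d + (3 + 2 * L) * \<epsilon>"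
    using n z' by (intro exI[of _ "n + m"] conjI exI[of _ v]) auto
qed

section \<open>The barrier on the Aubry set\<close>

text \<open>If \<open>z\<close> nearly returns to \<open>x\<close>, so does the point obtained by putting \<open>k\<close> copies of the first
  \<open>n\<close> symbols of \<open>z\<close> in front of \<open>x\<close>. Each copy at least halves the error already present, so the error
  stays bounded uniformly in \<open>k\<close>.\<close>

lemma dist_iterated_graft_le:
  assumes "n \<ge> 1" "dist x z < \<epsilon>" "dist ((shift ^^ n) z) x < \<epsilon>"
  shows "dist ((graft n z ^^ k) x) x \<le> 3 * \<epsilon>"
proof (induction k)
  case 0
  have "0 < \<epsilon>"
    using assms(2) zero_le_dist[of x z] by linarith
  then show ?case
    by simp
next
  case (Suc k)
  let ?v = "(graft n z ^^ k) x"
  have "dist (graft n z ?v) z \<le> dist ?v ((shift ^^ n) z) / 2 ^ 1"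
    unfolding dist_graft_self using assms(1)
    by (intro divide_left_mono power_increasing) auto
  also have "\<dots> \<le> (dist ?v x + \<epsilon>) / 2"
    using dist_triangle[of ?v "(shift ^^ n) z" x] assms by (simp add: dist_commute)
  finally show ?case
    using Suc dist_triangle[of "graft n z ?v" x z] assms by (simp add: dist_commute)
qed

lemma birkhoff_sum_iterated_graft_le:
  assumes lip: "L-lipschitz_on UNIV \<psi>"
    and z: "n \<ge> 1" "dist x z < \<epsilon>" "dist ((shift ^^ n) z) x < \<epsilon>"
  shows "birkhoff_sum \<psi> (k * n) ((graft n z ^^ k) x) \<le> k * (birkhoff_sum \<psi> n z + 4 * L * \<epsilon>)"
proof (induction k)
  case (Suc k)
  let ?v = "(graft n z ^^ k) x"
  have "dist ?v ((shift ^^ n) z) \<le> 4 * \<epsilon>"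
    using dist_iterated_graft_le[OF z, of k] dist_triangle[of ?v "(shift ^^ n) z" x] z
    by (simp add: dist_commute)
  then have "L * dist ?v ((shift ^^ n) z) \<le> L * (4 * \<epsilon>)"
    using lip lipschitz_on_nonneg by (intro mult_left_mono) auto
  then have "birkhoff_sum \<psi> n (graft n z ?v) \<le> birkhoff_sum \<psi> n z + 4 * L * \<epsilon>"
    using birkhoff_sum_graft_self_le[OF lip, of n z ?v] by simp
  moreover have "birkhoff_sum \<psi> (Suc k * n) (graft n z ?v)
      = birkhoff_sum \<psi> n (graft n z ?v) + birkhoff_sum \<psi> (k * n) ?v"
    by (simp add: birkhoff_sum_add shift_funpow_graft)
  ultimately show ?case
    using Suc by (simp add: algebra_simps)
qed (simp add: birkhoff_sum_def)

lemma shift_iterated_graft: "(shift ^^ (k * n)) ((graft n z ^^ k) x) = x"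
proof (induction k)
  case (Suc k)
  have "(shift ^^ (Suc k * n)) ((graft n z ^^ Suc k) x)
      = (shift ^^ (k * n)) ((shift ^^ n) (graft n z ((graft n z ^^ k) x)))"
    by (metis add.commute comp_apply funpow.simps(2) funpow_add mult_Suc)
  then show ?case
    by (simp add: shift_funpow_graft Suc)
qed simp

text \<open>The segments counted by the potential may be short, whereas the barrier requires arbitrarily
  long ones. A short nearly closed segment is therefore traversed \<open>Suc N\<close> times, after its
  errors have been chosen smaller by the factor \<open>Suc N\<close>.\<close>

lemma peierls_barrier_le_0_if_aubry:
  assumes lip: "L-lipschitz_on UNIV \<phi>" and x: "x \<in> aubry_set \<phi>"
  shows "peierls_barrier \<phi> x x \<le> ereal 0"
proof (rule peierls_barrier_leI)
  have L: "L \<ge> 0"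
    using lip lipschitz_on_nonneg by blast
  then show "3 + 4 * L > 0"
    by simp
  fix \<epsilon> :: real and N :: nat assume \<epsilon>: "0 < \<epsilon>"
  define \<eta> where "\<eta> = \<epsilon> / real (Suc N)"
  have \<eta>: "0 < \<eta>" "\<eta> \<le> \<epsilon>" "Suc N * \<eta> = \<epsilon>"
    using \<epsilon> by (auto simp: \<eta>_def divide_le_eq)
  have "mane_potential \<phi> x x \<le> ereal 0"
    using x by (simp add: aubry_set_def)
  then obtain n z where n: "n \<ge> 1" and z: "z \<in> orbit_nbhd x x n \<eta>"
    and sum: "birkhoff_sum (normalized \<phi>) n z < 0 + \<eta>"
    using \<eta>(1) \<eta>(1) by (rule mane_potential_leD)
  have z': "dist x z < \<eta>" "dist ((shift ^^ n) z) x < \<eta>"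
    using z by (auto simp: orbit_nbhd_def)
  define v where "v = (graft n z ^^ Suc N) x"
  have "dist x v \<le> 3 * \<epsilon>"
    using dist_iterated_graft_le[OF n z', of "Suc N"] \<eta> by (simp add: v_def dist_commute)
  then have "dist x v \<le> (3 + 4 * L) * \<epsilon>"
    using mult_nonneg_nonneg[of L \<epsilon>] L \<epsilon> unfolding distrib_right by linarith
  moreover have "birkhoff_sum (normalized \<phi>) (Suc N * n) v \<le> (3 + 4 * L) * \<epsilon>"
  proof -
    have "birkhoff_sum (normalized \<phi>) (Suc N * n) v
        \<le> Suc N * (birkhoff_sum (normalized \<phi>) n z + 4 * L * \<eta>)"
      unfolding v_def by (rule birkhoff_sum_iterated_graft_le[OF lipschitz_normalized[OF lip] n z'])
    also have "\<dots> \<le> Suc N * (\<eta> + 4 * L * \<eta>)"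
      using sum by (intro mult_left_mono) auto
    also have "\<dots> = (1 + 4 * L) * (Suc N * \<eta>)"
      by (simp add: algebra_simps)
    also have "\<dots> = (1 + 4 * L) * \<epsilon>"
      by (simp only: \<eta>(3))
    also have "\<dots> \<le> (3 + 4 * L) * \<epsilon>"
      using \<epsilon> by (intro mult_right_mono) auto
    finally show ?thesis .
  qed
  moreover have "(shift ^^ (Suc N * n)) v = x"
    unfolding v_def by (rule shift_iterated_graft)
  moreover have "Suc N * n \<ge> N"
    using n by (simp add: trans_le_add2)
  ultimately show "\<exists>n\<ge>N. \<exists>z. dist x z \<le> (3 + 4 * L) * \<epsilon> \<and> dist ((shift ^^ n) z) x \<le> (3 + 4 * L) * \<epsilon>
      \<and> birkhoff_sum (normalized \<phi>) n z \<le> 0 + (3 + 4 * L) * \<epsilon>"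
    using L \<epsilon> by (intro exI[of _ "Suc N * n"] conjI exI[of _ v]) (auto simp del: mult_Suc funpow.simps)
qed

lemma peierls_barrier_self_nonneg:
  assumes lip: "L-lipschitz_on UNIV \<phi>" and le: "peierls_barrier \<phi> x x \<le> ereal c"
  shows "0 \<le> c"
proof (rule field_le_epsilon)
  have L: "L \<ge> 0"
    using lip lipschitz_on_nonneg by blast
  fix \<delta> :: real assume "\<delta> > 0"
  define \<epsilon> where "\<epsilon> = \<delta> / (1 + 4 * L)"
  have \<epsilon>: "\<epsilon> > 0" "(1 + 4 * L) * \<epsilon> = \<delta>"
    using L \<open>\<delta> > 0\<close> by (auto simp: \<epsilon>_def)
  obtain n z where z: "dist x z < \<epsilon>" "dist ((shift ^^ n) z) x < \<epsilon>"
    "birkhoff_sum (normalized \<phi>) n z < c + \<epsilon>"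
    using peierls_barrier_leD[OF le \<epsilon>(1) \<epsilon>(1)] by metis
  have "dist z ((shift ^^ n) z) \<le> 2 * \<epsilon>"
    using dist_triangle[of z "(shift ^^ n) z" x] z by (simp add: dist_commute)
  then have "2 * L * dist z ((shift ^^ n) z) \<le> 2 * L * (2 * \<epsilon>)"
    using L by (intro mult_left_mono) auto
  then show "0 \<le> c + \<delta>"
    using birkhoff_sum_closing[OF lip, of z n] z \<epsilon>(2) by (simp add: algebra_simps)
qed

lemma peierls_barrier_finite:
  assumes lip: "L-lipschitz_on UNIV \<phi>" and x: "x \<in> aubry_set \<phi>"
  shows "\<bar>peierls_barrier \<phi> x y\<bar> \<noteq> \<infinity>"
proof -
  have "peierls_barrier \<phi> x y \<le> ereal (0 + L * dist x y)"
    using peierls_barrier_lipschitz[OF lip peierls_barrier_le_0_if_aubry[OF lip x]] .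
  moreover have "ereal (- (4 * L)) \<le> peierls_barrier \<phi> x y"
    by (rule ereal_le_real) (use peierls_barrier_bound[OF lip] in auto)
  ultimately show ?thesis
    by auto
qed

theorem theorem2:
  fixes \<phi> :: "unit_seq \<Rightarrow> real"
  assumes "\<exists>L. L-lipschitz_on UNIV \<phi>"
  shows "(\<forall>x\<in>aubry_set \<phi>.
            (\<forall>y. \<bar>peierls_barrier \<phi> x y\<bar> \<noteq> \<infinity>) \<and>
            (\<exists>L. L-lipschitz_on UNIV (\<lambda>y. real_of_ereal (peierls_barrier \<phi> x y))) \<and>
            calibrated_subaction \<phi> (\<lambda>y. real_of_ereal (peierls_barrier \<phi> x y))) \<and>
         equiv (aubry_set \<phi>)
           {(x, y). x \<in> aubry_set \<phi> \<and> y \<in> aubry_set \<phi> \<and>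
                    peierls_barrier \<phi> x y + peierls_barrier \<phi> y x = 0}"
proof -
  obtain L where lip: "L-lipschitz_on UNIV \<phi>"
    using assms by blast
  define h where "h x y = real_of_ereal (peierls_barrier \<phi> x y)" for x y
  have h: "peierls_barrier \<phi> x y = ereal (h x y)" if "x \<in> aubry_set \<phi>" for x y
    using peierls_barrier_finite[OF lip that] by (simp add: h_def ereal_real)
  have h_lip: "L-lipschitz_on UNIV (h x)" if x: "x \<in> aubry_set \<phi>" for x
  proof (rule lipschitz_onI)
    have "h x y' \<le> h x y + L * dist y y'" for y y'
      using peierls_barrier_lipschitz[OF lip, of x y "h x y" y'] h[OF x] by simp
    then show "dist (h x y) (h x y') \<le> L * dist y y'" for y y'
      by (smt (verit) dist_commute dist_real_def)
    show "L \<ge> 0"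
      using lip lipschitz_on_nonneg by blast
  qed
  have h_sub: "h x (shift y) + ergodic_min \<phi> \<le> h x y + \<phi> y" if "x \<in> aubry_set \<phi>" for x y
    using peierls_barrier_shift_le[OF lip, of x y "h x y"] h[OF that] by simp
  have h_cal: "calibrated_subaction \<phi> (h x)" if x: "x \<in> aubry_set \<phi>" for x
    unfolding calibrated_subaction_def subaction_def
  proof (intro conjI allI)
    show "continuous_on UNIV (h x)"
      using h_lip[OF x] by (rule lipschitz_on_continuous_on)
    fix y
    show "h x (shift y) + ergodic_min \<phi> \<le> h x y + \<phi> y"
      by (rule h_sub[OF x])
    obtain y' where y': "shift y' = y" "h x y' \<le> h x y - normalized \<phi> y'"
      using peierls_barrier_preimage[OF lip, of x y "h x y"] h[OF x] by auto
    then have eq: "\<phi> y' + h x y' = h x y + ergodic_min \<phi>"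
      using h_sub[OF x, of y'] by simp
    have "\<phi> y' + h x y' \<le> \<phi> w + h x w" if "shift w = y" for w
      using h_sub[OF x, of w] that eq by simp
    with y'(1) eq show "\<exists>y'. is_arg_min (\<lambda>y. \<phi> y + h x y) (\<lambda>w. shift w = y) y' \<and>
        \<phi> y' + h x y' = h x y + ergodic_min \<phi>"
      by (auto simp: is_arg_min_linorder)
  qed
  have h_triangle: "h x w \<le> h x y + h y w" if "x \<in> aubry_set \<phi>" "y \<in> aubry_set \<phi>" for x y w
    using peierls_barrier_triangle[OF lip, of x y "h x y" w "h y w"] that by (simp add: h)
  have h_self: "h x x = 0" if x: "x \<in> aubry_set \<phi>" for x
    using peierls_barrier_le_0_if_aubry[OF lip x] peierls_barrier_self_nonneg[OF lip, of x "h x x"]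
    by (simp add: h[OF x])
  define R where "R = {(x, y). x \<in> aubry_set \<phi> \<and> y \<in> aubry_set \<phi> \<and> h x y + h y x = 0}"
  have "equiv (aubry_set \<phi>) R"
  proof (rule equivI)
    show "R \<subseteq> aubry_set \<phi> \<times> aubry_set \<phi>"
      by (auto simp: R_def)
    show "refl_on (aubry_set \<phi>) R"
      by (rule refl_onI) (auto simp: R_def h_self)
    show "sym R"
      by (rule symI) (auto simp: R_def add.commute)
    show "trans R"
    proof (rule transI)
      fix x y w
      assume *: "(x, y) \<in> R" "(y, w) \<in> R"
      have "0 \<le> h x w + h w x"
        using h_triangle[of x w x] h_self[of x] * by (auto simp: R_def)
      moreover have "h x w + h w x \<le> 0"
        using h_triangle[of x y w] h_triangle[of w y x] * by (auto simp: R_def)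
      ultimately show "(x, w) \<in> R"
        using * by (auto simp: R_def)
    qed
  qed
  moreover have "R = {(x, y). x \<in> aubry_set \<phi> \<and> y \<in> aubry_set \<phi> \<and>
      peierls_barrier \<phi> x y + peierls_barrier \<phi> y x = 0}"
    by (auto simp: R_def h)
  moreover have "\<exists>L. L-lipschitz_on UNIV (h x)" if "x \<in> aubry_set \<phi>" for x
    using h_lip[OF that] by blast
  ultimately show ?thesis
    using peierls_barrier_finite[OF lip] h_cal unfolding h_def by metis
qed

end
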